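(* Let $n=2$, $l=1$, and assume $a_j>\lambda_j^2$ for $j=1,2$. Let $\tilde B_{u1},\tilde B_{p2}\in\mathbb R^2$ be column vectors such that the $2\times2$ matrix $(\tilde B_{u1},\tilde B_{p2})$ is invertible, and put $\tilde B_{u2}=-H\tilde B_{u1}$. Then there is $\delta>0$ such that for every $\tilde B_{p1}\in\mathbb R^2$ with $|\tilde B_{p1}|<\delta$, the $2\times4$ boundary matrix $B=(B_u,B_p)$ determined by $$(B_uT,B_pT)=(\tilde B_{u1},\tilde B_{u2},\tilde B_{p1},\tilde B_{p2})$$ satisfies the generalized Kreiss condition (GKC).
   Context: $F$ is a real $2\times2$ matrix, $T$ is real invertible with $T^{-1}FT=\mathrm{diag}(\lambda_1,\lambda_2)$, $\lambda_1>0>\lambda_2$, and $\bar A=T\,\mathrm{diag}(a_1,a_2)T^{-1}$ with $a_j>0$. $T=(R_1^U,R_1^S)$ with $R_1^U,R_1^S$ its first and second columns. $\hat B$ is a real $1\times2$ matrix with $\hat BR_1^U\ne0$ and $H=-(\hat BR_1^U)^{-1}\hat BR_1^S\in\mathbb R$. GKC: let $A=\begin{pmatrix}F&I_2\\ \bar A-F^2&-F\end{pmatrix}$, $S=\mathrm{diag}(0,-I_2)$, $M(\eta,\xi_0)=A^{-1}(\eta S-\xi_0I_4)$ for $\eta\ge0$, $\xi_0\in\mathbb C$, $\mathrm{Re}\,\xi_0>0$; $M$ has exactly $2$ eigenvalues (with multiplicity) of negative real part. A right-stable matrix $R_M^S(\eta,\xi_0)$ is a full-rank $4\times2$ matrix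 with $MR_M^S=R_M^SS_-$ where all eigenvalues of the $2\times2$ matrix $S_-$ have negative real part. $B$ satisfies the GKC if there is $c_K>0$ such that $|\det\{BR_M^S(\eta,\xi_0)\}|\ge c_K\sqrt{\det\{R_M^{S*}(\eta,\xi_0)R_M^S(\eta,\xi_0)\}}$ for all $\eta\ge0$ and $\mathrm{Re}\,\xi_0>0$ ($*$: conjugate transpose; independent of the choice of $R_M^S$). *)

theory Defs
  imports "HOL-Analysis.Analysis"
begin

text \<open>
  A matrix with \<open>m\<close> rows and \<open>n\<close> columns has type \<open>'a^'n^'m\<close> with \<open>m = CARD('m)\<close> and
  \<open>n = CARD('n)\<close>. Block matrices are indexed by sum types, \<open>Inl\<close> being the first and
  \<open>Inr\<close> the second block of indices; so \<open>'n + 'n\<close> with \<open>'n = 2\<close> is an index type with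
  four elements.
\<close>

definition row_block :: "'a^'n^'l \<Rightarrow> 'a^'m^'l \<Rightarrow> 'a^('n + 'm)^'l" where
  "row_block A B = (\<chi> i j. case j of Inl k \<Rightarrow> A $ i $ k | Inr k \<Rightarrow> B $ i $ k)"

definition four_block ::
  "'a^'n^'l \<Rightarrow> 'a^'m^'l \<Rightarrow> 'a^'n^'k \<Rightarrow> 'a^'m^'k \<Rightarrow> 'a^('n + 'm)^('l + 'k)" where
  "four_block A B C D =
     (\<chi> i. case i of Inl p \<Rightarrow> row_block A B $ p | Inr q \<Rightarrow> row_block C D $ q)"

definition cols2 :: "'a::zero^'n \<Rightarrow> 'a^'n \<Rightarrow> 'a^2^'n" where
  "cols2 v w = (\<chi> i. vector [v $ i, w $ i])"

definition diag2 :: "'a::zero \<Rightarrow> 'a \<Rightarrow> 'a^2^2" where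
  "diag2 a b = vector [vector [a, 0], vector [0, b]]"

definition conj_transpose :: "complex^'n^'m \<Rightarrow> complex^'m^'n" where
  "conj_transpose R = (\<chi> i j. cnj (R $ j $ i))"

definition is_eigenvalue :: "'a::field^'n^'n \<Rightarrow> 'a \<Rightarrow> bool" where
  "is_eigenvalue A s \<longleftrightarrow> (\<exists>v. v \<noteq> 0 \<and> A *v v = s *s v)"

definition A_mat :: "real^'n::finite^'n \<Rightarrow> real^'n^'n \<Rightarrow> real^('n + 'n)^('n + 'n)" where
  "A_mat F Abar = four_block F (mat 1) (Abar - F ** F) (- F)"

definition S_mat :: "real^('n::finite + 'n)^('n + 'n)" where
  "S_mat = four_block 0 0 0 (- mat 1)"

text \<open>Note that \<open>mat \<xi>\<close> is \<open>\<xi>\<close> times the identity matrix.\<close>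

definition M_mat ::
  "real^'n::finite^'n \<Rightarrow> real^'n^'n \<Rightarrow> real \<Rightarrow> complex \<Rightarrow> complex^('n + 'n)^('n + 'n)" where
  "M_mat F Abar \<eta> \<xi> =
     map_matrix complex_of_real (matrix_inv (A_mat F Abar)) **
       (map_matrix complex_of_real (\<eta> *\<^sub>R S_mat) - mat \<xi>)"

definition right_stable :: "complex^('n::finite + 'n)^('n + 'n) \<Rightarrow> complex^'n^('n + 'n) \<Rightarrow> bool" where
  "right_stable M R \<longleftrightarrow>
     rank R = CARD('n) \<and>
     (\<exists>S :: complex^'n^'n. M ** R = R ** S \<and> (\<forall>s. is_eigenvalue S s \<longrightarrow> Re s < 0))"

text \<open>
  The estimate does not depend on the choice of the right-stable matrix (replacing \<open>R\<close> by
  \<open>R ** Z\<close> with \<open>Z\<close> invertible multiplies both sides by \<open>\<bar>det Z\<bar>\<close>), hence the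
  quantification over all of them. The Gram determinant \<open>det (R\<^sup>* R)\<close> is real and
  nonnegative, so taking its real part loses nothing.
\<close>

definition GKC ::
  "real^'n::finite^'n \<Rightarrow> real^'n^'n \<Rightarrow> real^('n + 'n)^'n \<Rightarrow> bool" where
  "GKC F Abar B \<longleftrightarrow>
     (\<exists>c>0. \<forall>\<eta>\<ge>0. \<forall>\<xi>. Re \<xi> > 0 \<longrightarrow>
        (\<forall>R. right_stable (M_mat F Abar \<eta> \<xi>) R \<longrightarrow>
           cmod (det (map_matrix complex_of_real B ** R))
             \<ge> c * sqrt (Re (det (conj_transpose R ** R)))))"

end

theory Submission
  imports Defs
begin

text \<open>
  The change of variables \<open>T\<close> diagonalises \<open>F\<close> and \<open>Abar\<close> simultaneously, so the problem
  decouples into two scalar modes \<open>(u, p)\<close>, one for each pair \<open>(lam, a)\<close> with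
  \<open>lam\<^sup>2 < a\<close>. In each mode the eigenvalues \<open>k\<close> of \<open>M_mat\<close> solve
  \<open>a * k\<^sup>2 - lam * eta * k = xi * (eta + xi)\<close>, and \<open>lam\<^sup>2 < a\<close> guarantees that at most one of
  them is stable (\<open>stable_root_sharp\<close>).

  The whole point is a bound on the slope of the stable eigenvector that is uniform in \<open>eta \<ge> 0\<close>
  and \<open>Re xi > 0\<close>. Since \<open>\<bar>k\<bar>\<close> is always at least a multiple of \<open>\<bar>xi\<bar>\<close>, one has
  \<open>p = \<tau> u\<close> with \<open>\<tau>\<close> bounded. If \<open>lam < 0\<close>, the stable root also dominates \<open>eta\<close>, and
  \<open>u = \<sigma> p\<close> with \<open>\<sigma>\<close> bounded (\<open>mode_bounds\<close>). The first relation is used in the mode of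
  \<open>lam1\<close>, the second in the mode of \<open>lam2\<close>. Consequently every right-stable matrix is
  \<open>K(\<tau>, \<sigma>) ** Z\<close> with a \<open>2 \<times> 2\<close> matrix \<open>Z\<close> and \<open>K\<close> depending only on \<open>T\<close> and on
  \<open>\<tau>, \<sigma>\<close> in a compact set (\<open>stable_subspace_form\<close>).

  Both sides of the Kreiss estimate scale with \<open>\<bar>det Z\<bar>\<close>. The Gram determinant of \<open>K\<close> is bounded by
  compactness (\<open>gram_bounded\<close>). The boundary matrix applied to \<open>K\<close> has the columns
  \<open>Bu1 + \<tau> Bp1\<close> and \<open>\<sigma> Bu2 + Bp2\<close>; because \<open>Bu2\<close> is a multiple of \<open>Bu1\<close>, their determinant
  is \<open>det (Bu1, Bp2)\<close> up to an error that is at most a constant times the norm of \<open>Bp1\<close>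
  (\<open>det_boundary_columns_ge\<close>). For small \<open>Bp1\<close> it stays away from \<open>0\<close>.
\<close>

section \<open>Roots of the characteristic equation\<close>

text \<open>
  The quadratic is the characteristic equation of one scalar mode. Its two roots add up to
  \<open>lam * eta / a\<close>, so the conclusion says that the other root has positive real part. If
  both roots lay in the closed left half plane, the real part of the equation would give
  \<open>(Im xi)\<^sup>2 > a * (Im k)\<^sup>2\<close>, while its imaginary part would give \<open>\<bar>Im xi\<bar> \<le> \<bar>lam\<bar> * \<bar>Im k\<bar>\<close>; the condition
  \<open>lam\<^sup>2 < a\<close> makes these incompatible.
\<close>
lemma stable_root_sharp:
  fixes a lam eta :: real and xi k :: complex
  assumes "a > lam\<^sup>2" and "eta \<ge> 0" and "Re xi > 0" and "Re k < 0"
    and root: "a * k\<^sup>2 - lam * eta * k = xi * (eta + xi)"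
  shows "a * Re k < lam * eta"
proof (rule ccontr)
  assume "\<not> a * Re k < lam * eta"
  define p q x y where "p = - Re k" and "q = Im k" and "x = Re xi" and "y = Im xi"
  note defs = p_def q_def x_def y_def
  have a: "a > 0" using assms(1) by (meson le_less_trans zero_le_power2)
  have p: "p > 0" and x: "x > 0" using assms by (auto simp: defs)
  have sum: "a * p \<le> - lam * eta" using \<open>\<not> _\<close> by (simp add: defs)
  have re: "a * (p\<^sup>2 - q\<^sup>2) + lam * eta * p = x\<^sup>2 - y\<^sup>2 + eta * x"
    using arg_cong[OF root, of Re] by (simp add: defs power2_eq_square algebra_simps)
  have im: "q * (- (2 * a * p) - lam * eta) = y * (2 * x + eta)"
    using arg_cong[OF root, of Im] by (simp add: defs power2_eq_square algebra_simps)
  have "p * (- lam * eta - a * p) \<ge> 0" using p sum by simp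
  then have "y\<^sup>2 \<ge> a * q\<^sup>2 + x\<^sup>2 + eta * x" using re by (simp add: algebra_simps power2_eq_square)
  moreover have "x\<^sup>2 > 0" "eta * x \<ge> 0" using x assms by auto
  ultimately have y: "y\<^sup>2 > a * q\<^sup>2" by linarith
  \<comment> \<open>The bound on the sum of the roots forces \<open>lam < 0 < eta\<close>.\<close>
  have "lam * eta < 0" using mult_pos_pos[OF a p] sum by simp
  then have eta: "eta > 0" using assms(2) by (cases "eta = 0") auto
  have "\<bar>- (2 * a * p) - lam * eta\<bar> \<le> \<bar>lam * eta\<bar>"
    using sum mult_pos_pos[OF a p] by simp
  then have "\<bar>q\<bar> * \<bar>- (2 * a * p) - lam * eta\<bar> \<le> \<bar>q\<bar> * (\<bar>lam\<bar> * eta)"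
    using eta by (intro mult_left_mono) (auto simp: abs_mult)
  then have "\<bar>y\<bar> * (2 * x + eta) \<le> \<bar>q\<bar> * \<bar>lam\<bar> * eta"
    using arg_cong[OF im, of abs] x eta by (simp add: abs_mult)
  moreover have "\<bar>y\<bar> * eta \<le> \<bar>y\<bar> * (2 * x + eta)" using x by (intro mult_left_mono) auto
  ultimately have "\<bar>y\<bar> * eta \<le> (\<bar>q\<bar> * \<bar>lam\<bar>) * eta" by linarith
  then have "\<bar>y\<bar> \<le> \<bar>q\<bar> * \<bar>lam\<bar>" using eta by simp
  then have "y\<^sup>2 \<le> lam\<^sup>2 * q\<^sup>2"
    using power_mono[of "\<bar>y\<bar>" "\<bar>q\<bar> * \<bar>lam\<bar>" 2] by (simp add: power_mult_distrib mult.commute)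
  also have "\<dots> \<le> a * q\<^sup>2" using assms(1) by (intro mult_right_mono) auto
  finally show False using y by simp
qed

text \<open>
  For \<open>eta \<ge> 0\<close> and \<open>Re xi > 0\<close> there is no cancellation in \<open>eta + xi\<close>: its modulus
  dominates both \<open>eta\<close> and \<open>\<bar>xi\<bar>\<close>. A root much smaller than \<open>xi\<close> would therefore make
  the left-hand side of the equation smaller than its right-hand side.
\<close>
lemma cmod_le_root:
  fixes a lam eta :: real and xi k :: complex
  assumes "a > 0" and "eta \<ge> 0" and "Re xi > 0"
    and root: "a * k\<^sup>2 - lam * eta * k = xi * (eta + xi)"
  shows "cmod xi \<le> (a + \<bar>lam\<bar> + 1) * cmod k"
proof (rule ccontr)
  define C where "C = a + \<bar>lam\<bar> + 1"
  assume "\<not> ?thesis"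
  then have less: "C * cmod k < cmod xi" by (simp add: C_def)
  have C: "C \<ge> 1" using assms(1) by (simp add: C_def)
  have k: "cmod k \<le> cmod xi" using less C mult_right_mono[of 1 C "cmod k"] by simp
  define m where "m = cmod (eta + xi)"
  have "m\<^sup>2 = (eta + Re xi)\<^sup>2 + (Im xi)\<^sup>2" by (simp add: m_def cmod_power2)
  moreover have "(eta + Re xi)\<^sup>2 \<ge> eta\<^sup>2" "(eta + Re xi)\<^sup>2 \<ge> (Re xi)\<^sup>2"
    using assms by (intro power_mono; simp)+
  ultimately have "m\<^sup>2 \<ge> eta\<^sup>2" "m\<^sup>2 \<ge> (cmod xi)\<^sup>2"
    by (smt (verit) zero_le_power2, simp add: cmod_power2)
  then have m: "eta \<le> m" "cmod xi \<le> m"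
    by (auto intro: power2_le_imp_le simp: m_def)
  have m0: "m > 0" using m assms(3) complex_Re_le_cmod[of xi] by linarith
  have "xi * (eta + xi) = k * (a * k - lam * eta)"
    using root by (simp add: power2_eq_square algebra_simps)
  then have "cmod xi * m = cmod (k * (a * k - lam * eta))"
    unfolding m_def norm_mult[symmetric] by (rule arg_cong)
  also have "\<dots> = cmod k * cmod (a * k - lam * eta)" by (rule norm_mult)
  also have "\<dots> \<le> cmod k * (C * m)"
  proof (rule mult_left_mono)
    have "cmod (a * k - lam * eta) \<le> a * cmod k + \<bar>lam\<bar> * eta"
      using norm_triangle_ineq4[of "a * k" "lam * eta :: complex"] assms by (simp add: norm_mult)
    also have "\<dots> \<le> a * m + \<bar>lam\<bar> * m" using k m assms by (intro add_mono mult_left_mono) auto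
    also have "\<dots> \<le> C * m" using m0 by (simp add: C_def algebra_simps)
    finally show "cmod (a * k - lam * eta) \<le> C * m" .
  qed simp
  also have "\<dots> < cmod xi * m" using less m0 by (simp add: mult.assoc[symmetric]) (simp add: mult.commute)
  finally show False by simp
qed

section \<open>Stable solutions of a scalar mode\<close>

lemma left_eigenvalue_is_eigenvalue:
  fixes S :: "'a::field^'n^'n"
  assumes "z \<noteq> 0" and "z v* S = k *s z"
  shows "is_eigenvalue S k"
proof -
  have "z v* mat k = k *s z"
    by (simp add: vec_eq_iff vector_matrix_mult_def mat_def if_distrib mult.commute cong: if_cong)
  then have zero: "z v* (S - mat k) = 0"
    using assms(2) by (simp add: vector_matrix_mult_diff_rdistrib)
  have "\<nexists>B. (S - mat k) ** B = mat 1"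
    using zero assms(1) by (metis vector_matrix_mul_assoc vector_matrix_mul_rid vector_matrix_mult_0)
  then obtain v where "v \<noteq> 0" "(S - mat k) *v v = 0"
    by (metis matrix_left_invertible_ker invertible_left_inverse invertible_right_inverse)
  moreover have "mat k *v v = k *s v"
    by (simp add: vec_eq_iff matrix_vector_mult_def mat_def if_distrib if_distribR cong: if_cong)
  ultimately show ?thesis by (auto simp: is_eigenvalue_def matrix_vector_mult_diff_rdistrib)
qed

text \<open>
  The vectors \<open>u\<close> and \<open>p\<close> are corresponding rows of the two blocks of a right-stable matrix,
  in coordinates that decouple the problem into scalar modes; \<open>S\<close> acts on them from the right.
  If they were linearly independent, each root \<open>k\<close> of the characteristic equation
  \<open>a * k\<^sup>2 - lam * eta * k = xi * (eta + xi)\<close> would yield a left eigenvector of \<open>S\<close> in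
  their span, so both roots would lie in the open left half plane, against
  \<open>stable_root_sharp\<close>. Hence both rows are multiples of one row \<open>z\<close>, which is then a
  left eigenvector of \<open>S\<close> itself.
\<close>
lemma stable_mode:
  fixes S :: "complex^'n^'n" and u p :: "complex^'n" and lam a eta :: real and xi :: complex
  assumes a: "a > lam\<^sup>2" and eta: "eta \<ge> 0" and xi: "Re xi > 0"
    and stable: "\<And>s. is_eigenvalue S s \<Longrightarrow> Re s < 0"
    and eq_u: "- xi *s u = lam *s (u v* S) + p v* S"
    and eq_p: "- (eta + xi) *s p = (a - lam\<^sup>2) *s (u v* S) - lam *s (p v* S)"
    and nontrivial: "u \<noteq> 0 \<or> p \<noteq> 0"
  obtains z :: "complex^'n" and \<alpha> \<beta> k :: complex where "u = \<alpha> *s z" and "p = \<beta> *s z" and "Re k < 0"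
    and "- xi * \<alpha> = k * (lam * \<alpha> + \<beta>)"
    and "- (eta + xi) * \<beta> = k * ((a - lam\<^sup>2) * \<alpha> - lam * \<beta>)"
proof -
  have a0: "a > 0" using a by (meson le_less_trans zero_le_power2)
  have comps: "- xi * u $ i = lam * (u v* S) $ i + (p v* S) $ i"
    "- (eta + xi) * p $ i = (a - lam\<^sup>2) * (u v* S) $ i - lam * (p v* S) $ i" for i
    using arg_cong[OF eq_u, of "\<lambda>x. x $ i"] arg_cong[OF eq_p, of "\<lambda>x. x $ i"]
    by (simp_all only: vector_smult_component vector_add_component vector_minus_component)
  have uS: "a *s (u v* S) = - (lam * xi) *s u - (eta + xi) *s p" (is "?l = ?r")
    unfolding vec_eq_iff
  proof
    fix i show "?l $ i = ?r $ i" using comps[of i] by simp algebra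
  qed
  have pS: "a *s (p v* S) = - ((a - lam\<^sup>2) * xi) *s u + (lam * (eta + xi)) *s p" (is "?l = ?r")
    unfolding vec_eq_iff
  proof
    fix i show "?l $ i = ?r $ i" using comps[of i] by simp algebra
  qed
  have dep: "\<exists>z \<alpha> \<beta>. u = \<alpha> *s z \<and> p = \<beta> *s z"
  proof (rule ccontr)
    assume indep: "\<not> ?thesis"
    have all_stable: "Re k < 0" if root: "a * k\<^sup>2 - lam * eta * k = xi * (eta + xi)" for k :: complex
    proof -
      \<comment> \<open>The coefficients form a left eigenvector for \<open>k\<close> of the matrix given by \<open>uS\<close> and \<open>pS\<close>.\<close>
      define z where "z = ((a - lam\<^sup>2) * xi) *s u - (a * k + lam * xi) *s p"
      have "z \<noteq> 0"
      proof
        assume "z = 0"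
        then have "((a - lam\<^sup>2) * xi) *s u = (a * k + lam * xi) *s p" by (simp add: z_def)
        moreover have c: "(a - lam\<^sup>2) * xi \<noteq> 0"
          using a xi by (auto simp flip: of_real_power of_real_diff)
        ultimately have "u = ((a * k + lam * xi) / ((a - lam\<^sup>2) * xi)) *s p"
          by (simp add: vec_eq_iff field_simps)
        moreover have "p = 1 *s p" by simp
        ultimately show False using indep by blast
      qed
      moreover have "z v* S = k *s z"
      proof -
        have "a *s (z v* S) =
            ((a - lam\<^sup>2) * xi) *s (a *s (u v* S)) - (a * k + lam * xi) *s (a *s (p v* S))"
          by (simp add: z_def vector_matrix_mult_diff_distrib scalar_vector_matrix_assoc vec_eq_iff algebra_simps)
        also have "\<dots> = a *s (k *s z)" (is "?l = ?r")
          unfolding vec_eq_iff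
        proof
          fix i show "?l $ i = ?r $ i" unfolding uS pS z_def using root by simp algebra
        qed
        finally show ?thesis using a0 by (simp add: vec_eq_iff)
      qed
      ultimately show ?thesis using left_eigenvalue_is_eigenvalue stable by blast
    qed
    obtain k :: complex where k: "a * k\<^sup>2 - lam * eta * k = xi * (eta + xi)"
    proof
      define d where "d = csqrt ((lam * eta)\<^sup>2 + 4 * a * (xi * (eta + xi)))"
      have "d\<^sup>2 = (lam * eta)\<^sup>2 + 4 * a * (xi * (eta + xi))" by (simp add: d_def)
      then show "a * ((lam * eta + d) / (2 * a))\<^sup>2 - lam * eta * ((lam * eta + d) / (2 * a)) = xi * (eta + xi)"
        using a0 by (simp add: field_simps power2_eq_square)
    qed
    \<comment> \<open>The other root is \<open>c - k\<close>.\<close>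
    define c where "c = lam * eta / a"
    have c: "complex_of_real (lam * eta) = a * c" using a0 by (simp add: c_def)
    have "a * (c - k)\<^sup>2 - lam * eta * (c - k) = a * k\<^sup>2 - lam * eta * k"
      unfolding c by (simp add: power2_eq_square algebra_simps)
    then have "a * (c - k)\<^sup>2 - lam * eta * (c - k) = xi * (eta + xi)" using k by simp
    then have "Re (c - k) < 0" by (rule all_stable)
    moreover have "a * Re k < lam * eta"
      using stable_root_sharp[OF a eta xi all_stable[OF k] k] .
    ultimately show False using a0 by (simp add: c_def field_simps)
  qed
  then obtain z \<alpha> \<beta> where u: "u = \<alpha> *s z" and p: "p = \<beta> *s z" by blast
  have z: "z \<noteq> 0" and ab: "\<alpha> \<noteq> 0 \<or> \<beta> \<noteq> 0" using nontrivial u p by auto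
  have "\<exists>k. z v* S = k *s z"
  proof -
    have "\<alpha> *s (a *s (z v* S)) = (- (lam * xi) * \<alpha> - (eta + xi) * \<beta>) *s z"
      using uS unfolding u p by (simp add: scalar_vector_matrix_assoc vec_eq_iff algebra_simps)
    moreover have "\<beta> *s (a *s (z v* S)) = (- ((a - lam\<^sup>2) * xi) * \<alpha> + (lam * (eta + xi)) * \<beta>) *s z"
      using pS unfolding u p by (simp add: scalar_vector_matrix_assoc vec_eq_iff algebra_simps)
    moreover have "\<exists>k. z v* S = k *s z" if "c *s (a *s (z v* S)) = d *s z" "c \<noteq> 0" for c d :: complex
    proof
      show "z v* S = (d / (c * a)) *s z" using that a0 by (simp add: vec_eq_iff field_simps)
    qed
    ultimately show ?thesis using ab by blast
  qed
  then obtain k where k: "z v* S = k *s z" by blast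
  obtain i where i: "z $ i \<noteq> 0" using z by (auto simp: vec_eq_iff)
  have "- xi * \<alpha> = k * (lam * \<alpha> + \<beta>)"
    using arg_cong[OF eq_u, of "\<lambda>x. x $ i"] i unfolding u p
    by (simp add: scalar_vector_matrix_assoc k) algebra
  moreover have "- (eta + xi) * \<beta> = k * ((a - lam\<^sup>2) * \<alpha> - lam * \<beta>)"
    using arg_cong[OF eq_p, of "\<lambda>x. x $ i"] i unfolding u p
    by (simp add: scalar_vector_matrix_assoc k) algebra
  moreover have "Re k < 0"
    using stable left_eigenvalue_is_eigenvalue[OF z k] .
  ultimately show ?thesis using that u p by blast
qed

text \<open>
  Solving the first equation for \<open>\<beta>\<close> gives \<open>\<beta> = - (xi / k + lam) * \<alpha>\<close>, so a bound on
  \<open>xi / k\<close> suffices. Solving the second one for \<open>\<alpha>\<close> brings in \<open>(eta + xi) / k\<close>, and here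
  the sign of \<open>lam\<close> matters: for \<open>lam < 0\<close> the stable root carries more than the whole
  negative sum of the roots, so that \<open>\<bar>k\<bar> \<ge> \<bar>lam\<bar> * eta / a\<close>. (For \<open>lam > 0\<close> the stable
  root can vanish with \<open>xi\<close> while \<open>eta\<close> stays fixed.)
\<close>
lemma mode_bounds:
  fixes lam a eta :: real and xi k \<alpha> \<beta> :: complex
  assumes a: "a > lam\<^sup>2" and eta: "eta \<ge> 0" and xi: "Re xi > 0" and k: "Re k < 0"
    and e1: "- xi * \<alpha> = k * (lam * \<alpha> + \<beta>)"
    and e2: "- (eta + xi) * \<beta> = k * ((a - lam\<^sup>2) * \<alpha> - lam * \<beta>)"
  shows "cmod \<beta> \<le> (a + 2 * \<bar>lam\<bar> + 1) * cmod \<alpha>"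
    and "lam < 0 \<Longrightarrow>
      cmod \<alpha> \<le> (a + 2 * \<bar>lam\<bar> + 1 + a / \<bar>lam\<bar>) / (a - lam\<^sup>2) * cmod \<beta>"
proof -
  have a0: "a > 0" using a by (meson le_less_trans zero_le_power2)
  have k0: "cmod k > 0" using k by auto
  have root: "a * k\<^sup>2 - lam * eta * k = xi * (eta + xi)" if nz: "\<alpha> \<noteq> 0 \<or> \<beta> \<noteq> 0"
  proof -
    have "(a * k\<^sup>2 - lam * eta * k - xi * (eta + xi)) * \<alpha> = 0"
      using e1 e2 unfolding of_real_diff of_real_power of_real_mult by algebra
    moreover have "(a * k\<^sup>2 - lam * eta * k - xi * (eta + xi)) * \<beta> = 0"
      using e1 e2 unfolding of_real_diff of_real_power of_real_mult by algebra
    ultimately show ?thesis using nz by auto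
  qed
  have xi_le: "cmod xi \<le> (a + \<bar>lam\<bar> + 1) * cmod k" if "\<alpha> \<noteq> 0 \<or> \<beta> \<noteq> 0"
    using cmod_le_root[OF a0 eta xi root[OF that]] .
  show "cmod \<beta> \<le> (a + 2 * \<bar>lam\<bar> + 1) * cmod \<alpha>"
  proof (cases "\<alpha> = 0 \<and> \<beta> = 0")
    case False
    have "k * \<beta> = - (xi + k * lam) * \<alpha>" using e1 by (simp add: algebra_simps)
    then have "cmod k * cmod \<beta> = cmod (xi + k * lam) * cmod \<alpha>"
      by (metis norm_minus_cancel norm_mult)
    also have "\<dots> \<le> (cmod xi + cmod k * \<bar>lam\<bar>) * cmod \<alpha>"
      using norm_triangle_ineq[of xi "k * lam"] by (intro mult_right_mono) (auto simp: norm_mult)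
    also have "\<dots> \<le> (cmod k * (a + 2 * \<bar>lam\<bar> + 1)) * cmod \<alpha>"
      using xi_le False by (intro mult_right_mono) (auto simp: algebra_simps)
    finally show ?thesis using k0 by (simp add: mult.assoc)
  qed simp
  assume lam: "lam < 0"
  show "cmod \<alpha> \<le> (a + 2 * \<bar>lam\<bar> + 1 + a / \<bar>lam\<bar>) / (a - lam\<^sup>2) * cmod \<beta>"
  proof (cases "\<alpha> = 0 \<and> \<beta> = 0")
    case False
    have "a * Re k < lam * eta"
      using stable_root_sharp[OF a eta xi k root] False by blast
    then have "\<bar>lam\<bar> * eta \<le> a * cmod k"
      using lam a0 complex_Re_le_cmod[of "- k"] mult_left_mono[of "- Re k" "cmod k" a] by simp
    then have eta_le: "eta \<le> a / \<bar>lam\<bar> * cmod k" using lam by (simp add: field_simps)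
    have "k * ((a - lam\<^sup>2) * \<alpha>) = (k * lam - (eta + xi)) * \<beta>"
      using e2 by (simp add: algebra_simps)
    then have "cmod (k * ((a - lam\<^sup>2) * \<alpha>)) = cmod ((k * lam - (eta + xi)) * \<beta>)"
      by (rule arg_cong)
    moreover have "cmod (complex_of_real (a - lam\<^sup>2)) = a - lam\<^sup>2"
      using a by (simp only: norm_of_real)
    ultimately have "cmod k * ((a - lam\<^sup>2) * cmod \<alpha>) = cmod (k * lam - (eta + xi)) * cmod \<beta>"
      by (simp only: norm_mult)
    also have "\<dots> \<le> (cmod k * \<bar>lam\<bar> + eta + cmod xi) * cmod \<beta>"
    proof (rule mult_right_mono)
      have "cmod (k * lam - (eta + xi)) \<le> cmod (k * lam) + (cmod eta + cmod xi)"
        by (meson add_left_mono norm_triangle_ineq norm_triangle_ineq4 order_trans)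
      then show "cmod (k * lam - (eta + xi)) \<le> cmod k * \<bar>lam\<bar> + eta + cmod xi"
        using eta by (simp add: norm_mult)
    qed simp
    also have "\<dots> \<le> (cmod k * (a + 2 * \<bar>lam\<bar> + 1 + a / \<bar>lam\<bar>)) * cmod \<beta>"
      using xi_le False eta_le by (intro mult_right_mono) (auto simp: algebra_simps)
    finally have "(a - lam\<^sup>2) * cmod \<alpha> \<le> (a + 2 * \<bar>lam\<bar> + 1 + a / \<bar>lam\<bar>) * cmod \<beta>"
      using k0 by (simp add: mult.assoc)
    then show ?thesis using a by (simp add: field_simps)
  qed simp
qed

text \<open>
  The form in which the modes enter the estimate: the row \<open>u\<close> always controls the stable mode,
  and for \<open>lam < 0\<close> the row \<open>p\<close> controls it as well, uniformly in \<open>eta\<close> and \<open>xi\<close>.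
\<close>
lemma stable_row_bounds:
  fixes S :: "complex^'n^'n" and u p :: "complex^'n" and lam a eta :: real and xi :: complex
  assumes a: "a > lam\<^sup>2" and eta: "eta \<ge> 0" and xi: "Re xi > 0"
    and stable: "\<And>s. is_eigenvalue S s \<Longrightarrow> Re s < 0"
    and eq_u: "- xi *s u = lam *s (u v* S) + p v* S"
    and eq_p: "- (eta + xi) *s p = (a - lam\<^sup>2) *s (u v* S) - lam *s (p v* S)"
  shows "\<exists>\<tau>. p = \<tau> *s u \<and> cmod \<tau> \<le> a + 2 * \<bar>lam\<bar> + 1"
    and "lam < 0 \<Longrightarrow>
      \<exists>\<sigma>. u = \<sigma> *s p \<and> cmod \<sigma> \<le> (a + 2 * \<bar>lam\<bar> + 1 + a / \<bar>lam\<bar>) / (a - lam\<^sup>2)"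
proof -
  have ratio: "\<exists>c. y = c *s x \<and> cmod c \<le> C"
    if "x = \<alpha> *s z" "y = \<beta> *s z" "cmod \<beta> \<le> C * cmod \<alpha>" "C \<ge> 0"
    for x y z :: "complex^'n" and \<alpha> \<beta> C
  proof (cases "\<alpha> = 0")
    case True
    then show ?thesis using that by (intro exI[of _ 0]) simp
  next
    case False
    then show ?thesis using that
      by (intro exI[of _ "\<beta> / \<alpha>"]) (simp add: norm_divide field_simps)
  qed
  have a0: "a > 0" using a by (meson le_less_trans zero_le_power2)
  define C where "C = a + 2 * \<bar>lam\<bar> + 1"
  define D where "D = (a + 2 * \<bar>lam\<bar> + 1 + a / \<bar>lam\<bar>) / (a - lam\<^sup>2)"
  have CD: "C \<ge> 0" "D \<ge> 0" using a a0 by (auto simp: C_def D_def)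
  obtain z \<alpha> \<beta> where "u = \<alpha> *s z" "p = \<beta> *s z" "cmod \<beta> \<le> C * cmod \<alpha>"
    "lam < 0 \<Longrightarrow> cmod \<alpha> \<le> D * cmod \<beta>"
  proof (cases "u = 0 \<and> p = 0")
    case True
    show ?thesis by (rule that[of 0 0 0]) (use True in auto)
  next
    case False
    then have nt: "u \<noteq> 0 \<or> p \<noteq> 0" by blast
    show ?thesis
    proof (rule stable_mode[OF a eta xi stable eq_u eq_p nt])
      fix z :: "complex^'n" and \<alpha> \<beta> k :: complex
      assume up: "u = \<alpha> *s z" "p = \<beta> *s z" and k: "Re k < 0"
        and e: "- xi * \<alpha> = k * (lam * \<alpha> + \<beta>)"
          "- (eta + xi) * \<beta> = k * ((a - lam\<^sup>2) * \<alpha> - lam * \<beta>)"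
      show thesis
        by (rule that[OF up mode_bounds[OF a eta xi k e, folded C_def D_def]])
    qed
  qed
  note mode = this
  show "\<exists>\<tau>. p = \<tau> *s u \<and> cmod \<tau> \<le> a + 2 * \<bar>lam\<bar> + 1"
    using ratio[OF mode(1,2,3) CD(1)] unfolding C_def .
  show "\<exists>\<sigma>. u = \<sigma> *s p \<and> cmod \<sigma> \<le> (a + 2 * \<bar>lam\<bar> + 1 + a / \<bar>lam\<bar>) / (a - lam\<^sup>2)" if "lam < 0"
    using ratio[OF mode(2,1) mode(4)[OF that] CD(2)] unfolding D_def .
qed

section \<open>Block matrices\<close>

definition col_block :: "'a^'n^'l \<Rightarrow> 'a^'n^'m \<Rightarrow> 'a^'n^('l + 'm)" where
  "col_block U P = (\<chi> i. case i of Inl k \<Rightarrow> U $ k | Inr k \<Rightarrow> P $ k)"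

lemma sum_UNIV_Plus:
  fixes f :: "'a::finite + 'b::finite \<Rightarrow> 'c::comm_monoid_add"
  shows "(\<Sum>i\<in>UNIV. f i) = (\<Sum>i\<in>UNIV. f (Inl i)) + (\<Sum>i\<in>UNIV. f (Inr i))"
  by (subst UNIV_Plus_UNIV[symmetric], subst sum.Plus) (simp_all add: o_def)

lemma all_Plus: "(\<forall>i. Q i) \<longleftrightarrow> (\<forall>k. Q (Inl k)) \<and> (\<forall>k. Q (Inr k))"
  by (metis sum.exhaust)

lemmas block_simps = vec_eq_iff all_Plus matrix_matrix_mult_def sum_UNIV_Plus
  four_block_def row_block_def col_block_def

lemma four_block_col_block:
  "four_block A B C D ** col_block U P = col_block (A ** U + B ** P) (C ** U + D ** P)"
  by (simp add: block_simps)

lemma row_block_col_block: "row_block A B ** col_block U P = A ** U + B ** P"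
  by (simp add: block_simps)

lemma col_block_mult: "col_block U P ** S = col_block (U ** S) (P ** S)"
  by (simp add: block_simps)

lemma four_block_mult:
  "four_block A B C D ** four_block A' B' C' D' =
     four_block (A ** A' + B ** C') (A ** B' + B ** D') (C ** A' + D ** C') (C ** B' + D ** D')"
  by (simp add: block_simps)

lemma col_block_eq_iff: "col_block U P = col_block U' P' \<longleftrightarrow> U = U' \<and> P = P'"
  by (simp add: block_simps)

lemma obtain_col_block:
  obtains U P where "R = col_block U P"
proof
  show "R = col_block (\<chi> i. R $ Inl i) (\<chi> i. R $ Inr i)" by (simp add: block_simps)
qed

lemma four_block_mat_one: "four_block (mat 1) 0 0 (mat 1) = mat 1"
  by (simp add: block_simps mat_def)

lemma conj_transpose_gram_col_block:
  "conj_transpose (col_block U P) ** col_block U P = conj_transpose U ** U + conj_transpose P ** P"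
  by (simp add: block_simps conj_transpose_def)

lemma conj_transpose_mult: "conj_transpose (A ** B) = conj_transpose B ** conj_transpose A"
  by (simp add: vec_eq_iff conj_transpose_def matrix_matrix_mult_def mult.commute)

lemma det_conj_transpose: "det (conj_transpose (A :: complex^2^2)) = cnj (det A)"
  by (simp add: det_2 conj_transpose_def mult.commute)

abbreviation cmat :: "real^'n^'m \<Rightarrow> complex^'n^'m" where
  "cmat \<equiv> map_matrix complex_of_real"

lemma cmat_mult: "cmat (A ** B) = cmat A ** cmat B"
  by (simp add: vec_eq_iff matrix_matrix_mult_def)

lemma cmat_row_block: "cmat (row_block A B) = row_block (cmat A) (cmat B)"
  by (simp add: block_simps)

lemma cmat_mat: "cmat (mat c) = mat (complex_of_real c)"
  by (simp add: vec_eq_iff mat_def)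

lemma matrix_inv_right:
  fixes A :: "'a::field^'n^'n"
  assumes "invertible A"
  shows "A ** matrix_inv A = mat 1" "matrix_inv A ** A = mat 1"
  using someI_ex[OF assms[unfolded invertible_def]] by (auto simp: matrix_inv_def)

lemma matrix_algebra_distribs:
  fixes A B C :: "'a::comm_ring_1^'n^'n"
  shows "(A + B) ** C = A ** C + B ** C" "(A - B) ** C = A ** C - B ** C"
    "A ** (B - C) = A ** B - A ** C" "(- A) ** B = - (A ** B)" "A ** (- B) = - (A ** B)"
  by (simp_all add: vec_eq_iff matrix_matrix_mult_def algebra_simps sum.distrib sum_subtractf sum_negf)

text \<open>
  When \<open>F\<close> and \<open>Abar\<close> commute, the square of \<open>A_mat F Abar\<close> is block diagonal with both
  blocks equal to \<open>Abar\<close>.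
\<close>
lemma A_mat_invertible:
  fixes F Abar :: "real^'n^'n"
  assumes "invertible Abar" and comm: "F ** Abar = Abar ** F"
  shows "invertible (A_mat F Abar)"
proof -
  let ?i = "matrix_inv Abar"
  have sq: "A_mat F Abar ** A_mat F Abar = four_block Abar 0 0 Abar"
    unfolding A_mat_def four_block_mult
    by (simp add: matrix_algebra_distribs comm matrix_mul_assoc matrix_add_ldistrib)
  have "four_block Abar 0 0 Abar ** four_block ?i 0 0 ?i = mat 1"
    using matrix_inv_right[OF assms(1)] by (simp add: four_block_mult four_block_mat_one)
  then have "A_mat F Abar ** (A_mat F Abar ** four_block ?i 0 0 ?i) = mat 1"
    by (simp add: matrix_mul_assoc sq)
  then show ?thesis using invertible_right_inverse by blast
qed

text \<open>
  Multiplying by \<open>A_mat F Abar\<close> removes the inverse from the invariance relation and leaves one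
  equation for each block row.
\<close>
lemma M_mat_invariant_blocks:
  fixes F Abar :: "real^'n^'n" and S :: "complex^'n^'n"
  assumes "invertible (A_mat F Abar)"
    and "M_mat F Abar eta xi ** col_block U P = col_block U P ** S"
  shows "mat (- xi) ** U = (cmat F ** U + P) ** S"
    and "mat (- (eta + xi)) ** P = (cmat (Abar - F ** F) ** U - cmat F ** P) ** S"
proof -
  let ?A = "cmat (A_mat F Abar)" and ?N = "cmat (eta *\<^sub>R S_mat) - mat xi"
  have "?A ** cmat (matrix_inv (A_mat F Abar)) = mat 1"
    using matrix_inv_right(1)[OF assms(1)] by (simp add: cmat_mat flip: cmat_mult)
  then have "?N ** col_block U P = ?A ** (M_mat F Abar eta xi ** col_block U P)"
    by (simp add: M_mat_def matrix_mul_assoc)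
  also have "\<dots> = ?A ** (col_block U P ** S)" by (simp add: assms(2))
  finally have *: "?N ** col_block U P = ?A ** col_block (U ** S) (P ** S)"
    by (simp add: col_block_mult)
  have N: "?N = four_block (mat (- xi)) 0 0 (mat (- (eta + xi)))"
    by (simp add: block_simps S_mat_def mat_def)
  have A: "?A = four_block (cmat F) (mat 1) (cmat (Abar - F ** F)) (- cmat F)"
    by (simp add: block_simps A_mat_def mat_def)
  show "mat (- xi) ** U = (cmat F ** U + P) ** S"
    and "mat (- (eta + xi)) ** P = (cmat (Abar - F ** F) ** U - cmat F ** P) ** S"
    using * unfolding N A four_block_col_block col_block_eq_iff
    by (simp_all add: matrix_algebra_distribs matrix_mul_assoc)
qed

section \<open>Stable subspaces and the Kreiss estimate\<close>

lemma matrix_mult_row: "(A ** S) $ i = A $ i v* S" for S :: "'a::comm_ring_1^'n^'m"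
  by (simp add: vec_eq_iff matrix_matrix_mult_def vector_matrix_mult_def mult.commute)

lemma scalar_mat_row: "(mat c ** X) $ i = c *s X $ i" for c :: "'a::comm_ring_1"
  by (simp add: vec_eq_iff matrix_matrix_mult_def mat_def if_distrib if_distribR cong: if_cong)

lemma diag2_mult_row:
  "(diag2 a b ** X) $ 1 = a *s X $ 1" "(diag2 a b ** X) $ 2 = b *s X $ 2"
  for a b :: "'a::comm_ring_1"
  by (simp_all add: vec_eq_iff matrix_matrix_mult_def diag2_def sum_2)

lemma diag2_mult: "diag2 a b ** diag2 c d = diag2 (a * c) (b * d)" for a b :: "'a::comm_ring_1"
  by (simp add: vec_eq_iff forall_2 matrix_matrix_mult_def diag2_def sum_2)

lemma cmat_diag2: "cmat (diag2 a b) = diag2 (complex_of_real a) (complex_of_real b)"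
  by (simp add: vec_eq_iff forall_2 diag2_def)

lemma mat_mult_commute: "mat c ** (A ** B) = A ** (mat c ** B)" for c :: "'a::comm_ring_1"
  by (simp add: vec_eq_iff matrix_matrix_mult_def mat_def if_distrib if_distribR
      sum_distrib_left mult.left_commute cong: if_cong)

text \<open>
  In the eigenbasis \<open>T\<close> of \<open>F\<close> and \<open>Abar\<close> the problem splits into two scalar modes. The
  mode with \<open>lam1\<close> is expressed through its first component and the mode with \<open>lam2 < 0\<close>
  through its second one; the rows of \<open>Z\<close> are these two leading components. All dependence of
  the stable subspace on \<open>eta\<close> and \<open>xi\<close> is then in the two bounded numbers \<open>\<tau>\<close> and
  \<open>\<sigma>\<close>.
\<close>
lemma stable_subspace_form:
  fixes F T Abar :: "real^2^2" and lam1 lam2 a1 a2 eta :: real and xi :: complex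
    and S :: "complex^2^2" and R :: "complex^2^(2 + 2)"
  assumes T: "invertible T"
    and F: "matrix_inv T ** F ** T = diag2 lam1 lam2"
    and Abar: "Abar = T ** diag2 a1 a2 ** matrix_inv T"
    and lam2: "lam2 < 0" and a: "a1 > lam1\<^sup>2" "a2 > lam2\<^sup>2"
    and eta: "eta \<ge> 0" and xi: "Re xi > 0"
    and inv: "M_mat F Abar eta xi ** R = R ** S"
    and stable: "\<And>s. is_eigenvalue S s \<Longrightarrow> Re s < 0"
  obtains \<tau> \<sigma> Z where
    "cmod \<tau> \<le> a1 + 2 * \<bar>lam1\<bar> + 1"
    "cmod \<sigma> \<le> (a2 + 2 * \<bar>lam2\<bar> + 1 + a2 / \<bar>lam2\<bar>) / (a2 - lam2\<^sup>2)"
    "R = col_block (cmat T ** diag2 1 \<sigma> ** Z) (cmat T ** diag2 \<tau> 1 ** Z)"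
proof -
  define Ti where "Ti = matrix_inv T"
  have TTi: "T ** Ti = mat 1" and TiT: "Ti ** T = mat 1"
    using matrix_inv_right[OF T] by (simp_all add: Ti_def)
  have TiF: "Ti ** F = diag2 lam1 lam2 ** Ti"
    by (metis F Ti_def TTi matrix_mul_assoc matrix_mul_rid)
  have TiA: "Ti ** Abar = diag2 a1 a2 ** Ti"
    by (simp add: Abar matrix_mul_assoc TiT flip: Ti_def)
  have cancel: "X = Y" if "Ti ** X = Ti ** Y" for X Y :: "real^2^2"
    using that by (metis TTi matrix_mul_assoc matrix_mul_lid)
  have a0: "a1 \<noteq> 0" "a2 \<noteq> 0" using a by (auto simp: not_less)
  have "invertible Abar"
  proof -
    have "diag2 a1 a2 ** diag2 (1 / a1) (1 / a2) = mat 1"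
      using a0 by (simp add: diag2_mult) (simp add: vec_eq_iff forall_2 diag2_def mat_def)
    then have "invertible (diag2 a1 a2)" using invertible_right_inverse by blast
    moreover have "invertible Ti" using TTi invertible_left_inverse by blast
    ultimately show ?thesis using T by (simp add: Abar invertible_mult flip: Ti_def)
  qed
  moreover have "F ** Abar = Abar ** F"
  proof (rule cancel)
    have "Ti ** (F ** Abar) = diag2 lam1 lam2 ** diag2 a1 a2 ** Ti"
      by (metis TiF TiA matrix_mul_assoc)
    also have "\<dots> = diag2 a1 a2 ** diag2 lam1 lam2 ** Ti" by (simp add: diag2_mult mult.commute)
    also have "\<dots> = Ti ** (Abar ** F)" by (metis TiF TiA matrix_mul_assoc)
    finally show "Ti ** (F ** Abar) = Ti ** (Abar ** F)" .
  qed
  ultimately have A: "invertible (A_mat F Abar)" by (rule A_mat_invertible)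
  obtain U P where R: "R = col_block U P" by (rule obtain_col_block)
  define U' P' where "U' = cmat Ti ** U" and "P' = cmat Ti ** P"
  have U: "U = cmat T ** U'" and P: "P = cmat T ** P'"
    by (simp_all add: U'_def P'_def matrix_mul_assoc TTi cmat_mat flip: cmat_mult)
  have TiAF: "Ti ** (Abar - F ** F) = diag2 (a1 - lam1\<^sup>2) (a2 - lam2\<^sup>2) ** Ti"
  proof -
    have "Ti ** (F ** F) = diag2 lam1 lam2 ** diag2 lam1 lam2 ** Ti"
      by (metis TiF matrix_mul_assoc)
    moreover have "diag2 a1 a2 - diag2 (lam1\<^sup>2) (lam2\<^sup>2) = diag2 (a1 - lam1\<^sup>2) (a2 - lam2\<^sup>2)"
      by (simp add: vec_eq_iff forall_2 diag2_def)
    ultimately show ?thesis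
      by (simp add: matrix_algebra_distribs TiA diag2_mult power2_eq_square flip: matrix_algebra_distribs(2))
  qed
  note blocks = M_mat_invariant_blocks[OF A inv[unfolded R]]
  have cF: "cmat Ti ** cmat F = diag2 lam1 lam2 ** cmat Ti"
    using arg_cong[OF TiF, of cmat] by (simp add: cmat_mult cmat_diag2)
  have cAF: "cmat Ti ** cmat (Abar - F ** F) = diag2 (complex_of_real (a1 - lam1\<^sup>2)) (complex_of_real (a2 - lam2\<^sup>2)) ** cmat Ti"
    using arg_cong[OF TiAF, of cmat] by (simp add: cmat_mult cmat_diag2)
  have "cmat Ti ** (mat (- xi) ** U) = cmat Ti ** ((cmat F ** U + P) ** S)"
    by (simp only: blocks(1))
  then have eq1: "mat (- xi) ** U' = (diag2 lam1 lam2 ** U' + P') ** S"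
    unfolding mat_mult_commute[symmetric] U'_def P'_def
    by (simp add: matrix_add_ldistrib matrix_mul_assoc matrix_algebra_distribs cF)
  have "cmat Ti ** (mat (- (eta + xi)) ** P) =
      cmat Ti ** ((cmat (Abar - F ** F) ** U - cmat F ** P) ** S)"
    by (simp only: blocks(2))
  then have eq2: "mat (- (eta + xi)) ** P' =
      (diag2 (complex_of_real (a1 - lam1\<^sup>2)) (complex_of_real (a2 - lam2\<^sup>2)) ** U'
        - diag2 lam1 lam2 ** P') ** S"
    unfolding mat_mult_commute[symmetric] U'_def P'_def
    by (simp add: matrix_mul_assoc matrix_algebra_distribs cF cAF del: minus_add_distrib)
  have rows_u: "- xi *s U' $ 1 = lam1 *s (U' $ 1 v* S) + P' $ 1 v* S"
    "- xi *s U' $ 2 = lam2 *s (U' $ 2 v* S) + P' $ 2 v* S"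
    using arg_cong[OF eq1, of "\<lambda>X. X $ 1"] arg_cong[OF eq1, of "\<lambda>X. X $ 2"]
    unfolding matrix_mult_row[of _ S] scalar_mat_row
    by (simp_all add: diag2_mult_row vector_matrix_left_distrib scalar_vector_matrix_assoc)
  have rows_p: "- (eta + xi) *s P' $ 1 = (a1 - lam1\<^sup>2) *s (U' $ 1 v* S) - lam1 *s (P' $ 1 v* S)"
    "- (eta + xi) *s P' $ 2 = (a2 - lam2\<^sup>2) *s (U' $ 2 v* S) - lam2 *s (P' $ 2 v* S)"
    using arg_cong[OF eq2, of "\<lambda>X. X $ 1"] arg_cong[OF eq2, of "\<lambda>X. X $ 2"]
    unfolding matrix_mult_row[of _ S] scalar_mat_row
    by (simp_all add: diag2_mult_row vector_matrix_mult_diff_distrib scalar_vector_matrix_assoc)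
  obtain \<tau> where \<tau>: "P' $ 1 = \<tau> *s U' $ 1" "cmod \<tau> \<le> a1 + 2 * \<bar>lam1\<bar> + 1"
    using stable_row_bounds(1)[OF a(1) eta xi stable rows_u(1) rows_p(1)] by blast
  obtain \<sigma> where \<sigma>: "U' $ 2 = \<sigma> *s P' $ 2"
    "cmod \<sigma> \<le> (a2 + 2 * \<bar>lam2\<bar> + 1 + a2 / \<bar>lam2\<bar>) / (a2 - lam2\<^sup>2)"
    using stable_row_bounds(2)[OF a(2) eta xi stable rows_u(2) rows_p(2) lam2] by blast
  define Z :: "complex^2^2" where "Z = vector [U' $ 1, P' $ 2]"
  have "U' = diag2 1 \<sigma> ** Z"
    by (simp add: vec_eq_iff[of U'] forall_2 diag2_mult_row Z_def \<sigma>)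
  moreover have "P' = diag2 \<tau> 1 ** Z"
    by (simp add: vec_eq_iff[of P'] forall_2 diag2_mult_row Z_def \<tau>)
  ultimately have "R = col_block (cmat T ** diag2 1 \<sigma> ** Z) (cmat T ** diag2 \<tau> 1 ** Z)"
    by (simp add: R U P matrix_mul_assoc)
  then show ?thesis using that \<tau>(2) \<sigma>(2) by blast
qed

text \<open>
  The bounded range of \<open>\<tau>\<close> and \<open>\<sigma>\<close> is compact and the Gram determinant depends
  continuously on them.
\<close>
lemma gram_bounded:
  fixes W :: "complex^2^2"
  obtains g :: real where "g > 0" and
    "\<And>\<tau> \<sigma>. \<lbrakk>cmod \<tau> \<le> C; cmod \<sigma> \<le> D\<rbrakk> \<Longrightarrow>
      Re (det (conj_transpose (W ** diag2 1 \<sigma>) ** (W ** diag2 1 \<sigma>) +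
               conj_transpose (W ** diag2 \<tau> 1) ** (W ** diag2 \<tau> 1))) \<le> g"
proof -
  define G where "G = (\<lambda>(\<tau>, \<sigma>).
    Re (det (conj_transpose (W ** diag2 1 \<sigma>) ** (W ** diag2 1 \<sigma>) +
             conj_transpose (W ** diag2 \<tau> 1) ** (W ** diag2 \<tau> 1))))"
  let ?K = "cball (0 :: complex) C \<times> cball (0 :: complex) D"
  have "continuous_on ?K G"
    unfolding G_def case_prod_unfold det_2
    by (simp add: matrix_matrix_mult_def conj_transpose_def diag2_def sum_2)
       (intro continuous_intros)
  then have "bounded (G ` ?K)"
    by (intro compact_imp_bounded compact_continuous_image compact_Times compact_cball)
  then obtain g where g: "g > 0" "\<And>x. x \<in> ?K \<Longrightarrow> norm (G x) \<le> g"
    unfolding bounded_pos by auto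
  show ?thesis
  proof
    fix \<tau> \<sigma> :: complex assume "cmod \<tau> \<le> C" "cmod \<sigma> \<le> D"
    then show "Re (det (conj_transpose (W ** diag2 1 \<sigma>) ** (W ** diag2 1 \<sigma>) +
               conj_transpose (W ** diag2 \<tau> 1) ** (W ** diag2 \<tau> 1))) \<le> g"
      using g(2)[of "(\<tau>, \<sigma>)"] by (simp add: G_def)
  qed (rule g(1))
qed

text \<open>
  The two columns are \<open>Bu1 + \<tau> * Bp1\<close> and \<open>Bp2 - \<sigma> * H * Bu1\<close>. The term
  \<open>\<sigma> * H * Bu1\<close>, which need not be small, is parallel to \<open>Bu1\<close> and drops out of the
  determinant when \<open>Bp1 = 0\<close>; what remains besides \<open>det (cols2 Bu1 Bp2)\<close> is linear in
  \<open>Bp1\<close>.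
\<close>
lemma det_boundary_columns_ge:
  fixes Bu1 Bp1 Bp2 :: "real^2" and H C D :: real and \<tau> \<sigma> :: complex
  assumes C: "cmod \<tau> \<le> C" and D: "cmod \<sigma> \<le> D"
  shows "cmod (det (cmat (cols2 Bu1 (- H *\<^sub>R Bu1)) ** diag2 1 \<sigma> + cmat (cols2 Bp1 Bp2) ** diag2 \<tau> 1))
    \<ge> \<bar>det (cols2 Bu1 Bp2)\<bar> - C * (2 * (norm Bp2 + D * \<bar>H\<bar> * norm Bu1)) * norm Bp1"
proof -
  define w where "w i = complex_of_real (Bp2 $ i) - \<sigma> * H * Bu1 $ i" for i
  define e where "e = Bp1 $ 1 * w 2 - Bp1 $ 2 * w 1"
  let ?Q = "norm Bp2 + D * \<bar>H\<bar> * norm Bu1"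
  have w: "cmod (w i) \<le> ?Q" for i
  proof -
    have "cmod (w i) \<le> \<bar>Bp2 $ i\<bar> + cmod \<sigma> * \<bar>H\<bar> * \<bar>Bu1 $ i\<bar>"
      using norm_triangle_ineq4[of "complex_of_real (Bp2 $ i)" "\<sigma> * H * Bu1 $ i"]
      by (simp add: w_def norm_mult)
    also have "\<dots> \<le> ?Q"
      using D order_trans[OF norm_ge_zero D] component_le_norm_cart[of Bp2 i] component_le_norm_cart[of Bu1 i]
      by (intro add_mono mult_mono) auto
    finally show ?thesis .
  qed
  have "cmod e \<le> \<bar>Bp1 $ 1\<bar> * cmod (w 2) + \<bar>Bp1 $ 2\<bar> * cmod (w 1)"
    using norm_triangle_ineq4[of "Bp1 $ 1 * w 2" "Bp1 $ 2 * w 1"] by (simp add: e_def norm_mult)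
  also have "\<dots> \<le> norm Bp1 * ?Q + norm Bp1 * ?Q"
    using w component_le_norm_cart[of Bp1] by (intro add_mono mult_mono) auto
  finally have e: "cmod e \<le> 2 * ?Q * norm Bp1" by (simp add: algebra_simps)
  have "cmod (\<tau> * e) \<le> C * (2 * ?Q * norm Bp1)"
    unfolding norm_mult using C e by (intro mult_mono) (auto intro: order_trans[OF norm_ge_zero])
  moreover have "det (cmat (cols2 Bu1 (- H *\<^sub>R Bu1)) ** diag2 1 \<sigma> + cmat (cols2 Bp1 Bp2) ** diag2 \<tau> 1)
      = complex_of_real (det (cols2 Bu1 Bp2)) + \<tau> * e"
    by (simp add: det_2 cols2_def diag2_def matrix_matrix_mult_def sum_2 e_def w_def algebra_simps)
  moreover have "cmod (complex_of_real (det (cols2 Bu1 Bp2)) + \<tau> * e) \<ge> \<bar>det (cols2 Bu1 Bp2)\<bar> - cmod (\<tau> * e)"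
    using norm_diff_ineq[of "complex_of_real (det (cols2 Bu1 Bp2))" "\<tau> * e"] by simp
  ultimately show ?thesis by (simp add: mult.assoc)
qed

theorem proposition5p2:
  fixes F T Abar :: "real^2^2"
    and lam1 lam2 a1 a2 H :: real
    and Bhat :: "real^2^1"
    and Bu1 Bu2 Bp2 :: "real^2"
  assumes "invertible T"
    and "matrix_inv T ** F ** T = diag2 lam1 lam2"
    and "lam1 > 0" and "0 > lam2"
    and "a1 > 0" and "a2 > 0"
    and "Abar = T ** diag2 a1 a2 ** matrix_inv T"
    and "Bhat *v column 1 T \<noteq> 0"
    and "H = - inverse ((Bhat *v column 1 T) $ 1) * (Bhat *v column 2 T) $ 1"
    and "a1 > lam1\<^sup>2" and "a2 > lam2\<^sup>2"
    and "invertible (cols2 Bu1 Bp2)"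
    and "Bu2 = - H *\<^sub>R Bu1"
  shows "\<exists>\<delta>>0. \<forall>Bp1. norm Bp1 < \<delta> \<longrightarrow>
           (\<forall>Bu Bp :: real^2^2.
              Bu ** T = cols2 Bu1 Bu2 \<and> Bp ** T = cols2 Bp1 Bp2 \<longrightarrow>
              GKC F Abar (row_block Bu Bp))"
proof -
  define C where "C = a1 + 2 * \<bar>lam1\<bar> + 1"
  define D where "D = (a2 + 2 * \<bar>lam2\<bar> + 1 + a2 / \<bar>lam2\<bar>) / (a2 - lam2\<^sup>2)"
  define d where "d = \<bar>det (cols2 Bu1 Bp2)\<bar>"
  define L where "L = C * (2 * (norm Bp2 + D * \<bar>H\<bar> * norm Bu1))"
  have d: "d > 0" using assms(12) by (simp add: d_def invertible_det_nz)
  have "C \<ge> 0" "D \<ge> 0"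
    unfolding C_def D_def using assms(5,6,11) by (intro divide_nonneg_nonneg add_nonneg_nonneg; simp)+
  then have L: "L \<ge> 0" by (simp add: L_def)
  define \<delta> where "\<delta> = d / (2 * (L + 1))"
  have "\<delta> > 0" using d L by (simp add: \<delta>_def)
  moreover have "GKC F Abar (row_block Bu Bp)"
    if Bp1: "norm Bp1 < \<delta>" and Bu: "Bu ** T = cols2 Bu1 Bu2" and Bp: "Bp ** T = cols2 Bp1 Bp2"
    for Bp1 and Bu Bp :: "real^2^2"
  proof -
    obtain g where g: "g > 0" and gram: "\<And>\<tau> \<sigma>. \<lbrakk>cmod \<tau> \<le> C; cmod \<sigma> \<le> D\<rbrakk> \<Longrightarrow>
      Re (det (conj_transpose (cmat T ** diag2 1 \<sigma>) ** (cmat T ** diag2 1 \<sigma>) +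
               conj_transpose (cmat T ** diag2 \<tau> 1) ** (cmat T ** diag2 \<tau> 1))) \<le> g"
      using gram_bounded[of C D "cmat T"] by blast
    have small: "L * norm Bp1 \<le> d / 2"
    proof -
      have "L * norm Bp1 \<le> (L + 1) * \<delta>" using L Bp1 by (intro mult_mono) auto
      also have "\<dots> = d / 2" using L by (simp add: \<delta>_def field_simps)
      finally show ?thesis .
    qed
    define c where "c = d / (2 * sqrt g)"
    have bound: "c * sqrt (Re (det (conj_transpose R ** R))) \<le> cmod (det (cmat (row_block Bu Bp) ** R))"
      if eta: "eta \<ge> 0" and xi: "Re xi > 0" and R: "right_stable (M_mat F Abar eta xi) R"
      for eta xi R
    proof -
      from R obtain S where S: "M_mat F Abar eta xi ** R = R ** S"
        "\<And>s. is_eigenvalue S s \<Longrightarrow> Re s < 0"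
        unfolding right_stable_def by blast
      obtain \<tau> \<sigma> Z where \<tau>: "cmod \<tau> \<le> C" and \<sigma>: "cmod \<sigma> \<le> D"
        and R: "R = col_block (cmat T ** diag2 1 \<sigma> ** Z) (cmat T ** diag2 \<tau> 1 ** Z)"
        unfolding C_def D_def
        by (rule stable_subspace_form[OF assms(1,2,7,4,10,11) eta xi S])
      let ?X = "cmat T ** diag2 1 \<sigma>" and ?Y = "cmat T ** diag2 \<tau> 1"
      let ?N = "cmat (cols2 Bu1 Bu2) ** diag2 1 \<sigma> + cmat (cols2 Bp1 Bp2) ** diag2 \<tau> 1"
      let ?G = "conj_transpose ?X ** ?X + conj_transpose ?Y ** ?Y"
      have "cmat (row_block Bu Bp) ** R = ?N ** Z"
        by (simp add: R cmat_row_block row_block_col_block matrix_mul_assoc matrix_algebra_distribs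
            flip: Bu Bp cmat_mult)
      then have det_BR: "cmod (det (cmat (row_block Bu Bp) ** R)) = cmod (det ?N) * cmod (det Z)"
        by (simp add: det_mul norm_mult)
      have "conj_transpose R ** R = conj_transpose Z ** ?G ** Z"
        by (simp add: R conj_transpose_gram_col_block conj_transpose_mult matrix_mul_assoc
            matrix_algebra_distribs matrix_add_ldistrib)
      then have "det (conj_transpose R ** R) = complex_of_real ((cmod (det Z))\<^sup>2) * det ?G"
        unfolding complex_norm_square by (simp add: det_mul det_conj_transpose mult_ac)
      then have "Re (det (conj_transpose R ** R)) = (cmod (det Z))\<^sup>2 * Re (det ?G)"
        by (simp del: of_real_power)
      also have "\<dots> \<le> (cmod (det Z))\<^sup>2 * g"
        using gram[OF \<tau> \<sigma>] by (intro mult_left_mono) auto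
      finally have "sqrt (Re (det (conj_transpose R ** R))) \<le> cmod (det Z) * sqrt g"
        by (metis norm_ge_zero real_sqrt_le_mono real_sqrt_mult real_sqrt_unique)
      then have "c * sqrt (Re (det (conj_transpose R ** R))) \<le> c * (cmod (det Z) * sqrt g)"
        using d g by (intro mult_left_mono) (auto simp: c_def)
      also have "\<dots> = d / 2 * cmod (det Z)" using g by (simp add: c_def)
      also have "\<dots> \<le> cmod (det ?N) * cmod (det Z)"
      proof (rule mult_right_mono)
        have "d - L * norm Bp1 \<le> cmod (det ?N)"
          using det_boundary_columns_ge[OF \<tau> \<sigma>, of Bu1 Bp2 H Bp1]
          unfolding d_def L_def assms(13) .
        then show "d / 2 \<le> cmod (det ?N)" using small by simp
      qed simp
      finally show ?thesis by (simp add: det_BR)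
    qed
    have "c > 0" using d g by (simp add: c_def)
    then show ?thesis unfolding GKC_def using bound by blast
  qed
  ultimately show ?thesis by blast
qed

end
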